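(* Let $S$ be a finite set of schemas, $A'\subseteq A\subseteq\mathrm{Args}$ and $S'\subseteq S\cap\mathrm{Sch}(A)$. If $S'$ is overlapping over $A'$, then every coupling map $c$ for $S$ over an arbitrary set $D$ is entangled with respect to $S'$ over $A'$.
   Context: $\mathrm{Args}$ is a finite non-empty set of arguments, $\mathrm{Var}$ a set of variables. A quantification prefix $\wp$ is a finite word over $\{\exists x,\forall x:x\in\mathrm{Var}\}$ with each variable at most once; $\mathrm{vars}(\wp)$, $\exists(\wp)$, $\forall(\wp)$ are its variables, existential and universal variables; for $x_1,x_2\in\mathrm{vars}(\wp)$, $x_1<_\wp x_2$ iff $x_1$ occurs before $x_2$; for $y\in\exists(\wp)$, $\mathrm{Dep}_\wp(y)=\{x\in\forall(\wp):x<_\wp y\}$. A binding prefix $\flat$ is a finite word over pairs $(a,x)\in\mathrm{Args}\times\mathrm{Var}$ with each argument at most once, viewed as a partial function $\mathrm{Args}\rightharpoonup\mathrm{Var}$ with domain $\mathrm{args}(\flat)$ and range $\mathrm{vars}(\flat)$. $\mathrm{Asg}_D(P)$ is the set of functions $P\to D$. A Skolem map for $\wp$ over $D$ is $\theta:\mathrm{Asg}_D(\forall(\wp))\to\mathrm{Asg}_D(\mathrm{vars}(\wp))$ with $\theta(\chi)(x)=\chi(x)$ for universal $x$ and $\theta(\chi_1)(y)=\theta(\chi_2)(y)$ for existential $y$ whenever $\chi_1,\chi_2$ agree on $\mathrm{Dep}_\wp(y)$. A schema is $\sigma=(\wp(\sigma),\flat(\sigma))$ with $\mathrm{vars}(\wp(\sigma))=\mathrm{vars}(\flat(\sigma))$,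 $\mathrm{args}(\sigma)=\mathrm{args}(\flat(\sigma))$; $\mathrm{Sch}(A)$ = schemas with argument set $A$. A coupling map $c$ for $S$ over $D$ assigns each $\sigma\in S$ a Skolem map $c(\sigma)$ for $\wp(\sigma)$ over $D$. $c$ is entangled w.r.t. $S'$ over $A'$ iff there is $t:A'\to D$ such that for every $\sigma\in S'$ there is $\chi\in\mathrm{rng}(c(\sigma))$ with $t=(\chi\circ\flat(\sigma))|_{A'}$. For a schema $\sigma$: $\exists(\sigma)=\{a\in\mathrm{args}(\sigma):\flat(\sigma)(a)\in\exists(\wp(\sigma))\}$, $\forall(\sigma)=\mathrm{args}(\sigma)\setminus\exists(\sigma)$; $a_1\equiv_\sigma a_2$ iff $\flat(\sigma)(a_1)=\flat(\sigma)(a_2)$; for $a_1\in\forall(\sigma)$, $a_2\in\exists(\sigma)$, $a_1\rightsquigarrow_\sigma a_2$ iff $\flat(\sigma)(a_1)<_{\wp(\sigma)}\flat(\sigma)(a_2)$. Extended arguments: $E=\{(\sigma,a)\in S'\times A':A'\subseteq\mathrm{args}(\sigma)\}$; $(\sigma,a)$ is existential iff $a\in\exists(\sigma)$. Collapsing graph: vertices $E$, edge relation $\equiv$ the transitive closure of $\{(e_1,e_2)\in E^2: (\sigma_1=\sigma_2\Rightarrow a_1\equiv_{\sigma_1}a_2)\wedge(\sigma_1\ne\sigma_2\Rightarrow a_1=a_2)\}$, where $e_i=(\sigma_i,a_i)$. It is conflicting iff there are existential $e_1=(\sigma_1,a_1),e_2=(\sigma_2,a_2)\in E$ with $e_1\equiv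 e_2$ and such that, if $\sigma_1=\sigma_2$, then not $a_1\equiv_{\sigma_1}a_2$. Dependence graph: vertices $E$, with an edge from $e_1$ to $e_2=(\sigma,a_2)$ iff there is $e=(\sigma,a)\in E$ with $e_1\equiv e$ and $a\rightsquigarrow_\sigma a_2$. $S'$ is overlapping over $A'$ iff its collapsing graph is not conflicting and its dependence graph is acyclic.
   Formalization: The set D is assumed non-empty; for D empty the claim is false (e.g. S = S' empty and A = A' = {a}: S' is overlapping and the empty coupling map exists, but there is no function from {a} to D). *)

theory Defs
  imports Main "HOL-Library.FuncSet"
begin

datatype 'v quantified = Exists (qvar: 'v) | Forall (qvar: 'v)

type_synonym 'v qprefix = "'v quantified list"

definition is_qprefix :: "'v qprefix \<Rightarrow> bool" where
  "is_qprefix p \<longleftrightarrow> distinct (map qvar p)"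

definition qvars :: "'v qprefix \<Rightarrow> 'v set" where
  "qvars p = qvar ` set p"

definition evars :: "'v qprefix \<Rightarrow> 'v set" where
  "evars p = {x. Exists x \<in> set p}"

definition uvars :: "'v qprefix \<Rightarrow> 'v set" where
  "uvars p = {x. Forall x \<in> set p}"

definition before :: "'v qprefix \<Rightarrow> 'v \<Rightarrow> 'v \<Rightarrow> bool" where
  "before p x1 x2 \<longleftrightarrow>
    (\<exists>i j. i < j \<and> j < length p \<and> qvar (p ! i) = x1 \<and> qvar (p ! j) = x2)"

definition Dep :: "'v qprefix \<Rightarrow> 'v \<Rightarrow> 'v set" where
  "Dep p y = {x \<in> uvars p. before p x y}"

text \<open>The partial function given by a binding prefix \<open>b\<close> is \<^term>\<open>map_of b\<close>.\<close>

type_synonym ('a, 'v) bprefix = "('a \<times> 'v) list"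

definition is_bprefix :: "('a, 'v) bprefix \<Rightarrow> bool" where
  "is_bprefix b \<longleftrightarrow> distinct (map fst b)"

datatype ('a, 'v) schema = Schema (qpre: "'v qprefix") (bpre: "('a, 'v) bprefix")

definition is_schema :: "('a, 'v) schema \<Rightarrow> bool" where
  "is_schema \<sigma> \<longleftrightarrow>
    is_qprefix (qpre \<sigma>) \<and> is_bprefix (bpre \<sigma>) \<and> qvars (qpre \<sigma>) = ran (map_of (bpre \<sigma>))"

definition args :: "('a, 'v) schema \<Rightarrow> 'a set" where
  "args \<sigma> = dom (map_of (bpre \<sigma>))"

definition Sch :: "'a set \<Rightarrow> ('a, 'v) schema set" where
  "Sch A = {\<sigma>. is_schema \<sigma> \<and> args \<sigma> = A}"

definition Asg :: "'d set \<Rightarrow> 'x set \<Rightarrow> ('x \<Rightarrow> 'd) set" where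
  "Asg D P = P \<rightarrow>\<^sub>E D"

definition is_skolem_map :: "'v qprefix \<Rightarrow> 'd set \<Rightarrow> (('v \<Rightarrow> 'd) \<Rightarrow> ('v \<Rightarrow> 'd)) \<Rightarrow> bool" where
  "is_skolem_map p D \<theta> \<longleftrightarrow>
    \<theta> \<in> Asg D (uvars p) \<rightarrow>\<^sub>E Asg D (qvars p) \<and>
    (\<forall>\<chi> \<in> Asg D (uvars p). \<forall>x \<in> uvars p. \<theta> \<chi> x = \<chi> x) \<and>
    (\<forall>\<chi>1 \<in> Asg D (uvars p). \<forall>\<chi>2 \<in> Asg D (uvars p). \<forall>y \<in> evars p.
       (\<forall>x \<in> Dep p y. \<chi>1 x = \<chi>2 x) \<longrightarrow> \<theta> \<chi>1 y = \<theta> \<chi>2 y)"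

definition is_coupling_map ::
  "('a, 'v) schema set \<Rightarrow> 'd set \<Rightarrow> (('a, 'v) schema \<Rightarrow> ('v \<Rightarrow> 'd) \<Rightarrow> ('v \<Rightarrow> 'd)) \<Rightarrow> bool" where
  "is_coupling_map S D c \<longleftrightarrow> (\<forall>\<sigma> \<in> S. is_skolem_map (qpre \<sigma>) D (c \<sigma>))"

text \<open>
  A function from \<open>A'\<close> to \<open>D\<close> is rendered here as a map with domain \<open>A'\<close> and range inside \<open>D\<close>,
  so that the composition of an assignment with a binding prefix keeps its partiality.
  The range of a Skolem map is its image on the assignments of the universal variables only.
\<close>

definition entangled ::
  "'d set \<Rightarrow> (('a, 'v) schema \<Rightarrow> ('v \<Rightarrow> 'd) \<Rightarrow> ('v \<Rightarrow> 'd)) \<Rightarrow>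
    ('a, 'v) schema set \<Rightarrow> 'a set \<Rightarrow> bool" where
  "entangled D c S' A' \<longleftrightarrow>
    (\<exists>t :: 'a \<rightharpoonup> 'd. dom t = A' \<and> ran t \<subseteq> D \<and>
      (\<forall>\<sigma> \<in> S'. \<exists>\<chi> \<in> c \<sigma> ` Asg D (uvars (qpre \<sigma>)).
         t = ((\<lambda>x. Some (\<chi> x)) \<circ>\<^sub>m map_of (bpre \<sigma>)) |` A'))"

definition eargs :: "('a, 'v) schema \<Rightarrow> 'a set" where
  "eargs \<sigma> = {a \<in> args \<sigma>. the (map_of (bpre \<sigma>) a) \<in> evars (qpre \<sigma>)}"

definition uargs :: "('a, 'v) schema \<Rightarrow> 'a set" where
  "uargs \<sigma> = args \<sigma> - eargs \<sigma>"

definition arg_equiv :: "('a, 'v) schema \<Rightarrow> 'a \<Rightarrow> 'a \<Rightarrow> bool" where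
  "arg_equiv \<sigma> a1 a2 \<longleftrightarrow>
    a1 \<in> args \<sigma> \<and> a2 \<in> args \<sigma> \<and> map_of (bpre \<sigma>) a1 = map_of (bpre \<sigma>) a2"

definition arg_dep :: "('a, 'v) schema \<Rightarrow> 'a \<Rightarrow> 'a \<Rightarrow> bool" where
  "arg_dep \<sigma> a1 a2 \<longleftrightarrow>
    a1 \<in> uargs \<sigma> \<and> a2 \<in> eargs \<sigma> \<and>
    before (qpre \<sigma>) (the (map_of (bpre \<sigma>) a1)) (the (map_of (bpre \<sigma>) a2))"

definition ext_args ::
  "('a, 'v) schema set \<Rightarrow> 'a set \<Rightarrow> (('a, 'v) schema \<times> 'a) set" where
  "ext_args S' A' = {(\<sigma>, a). \<sigma> \<in> S' \<and> a \<in> A' \<and> A' \<subseteq> args \<sigma>}"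

definition collapsing ::
  "('a, 'v) schema set \<Rightarrow> 'a set \<Rightarrow> (('a, 'v) schema \<times> 'a) rel" where
  "collapsing S' A' =
    {((\<sigma>1, a1), (\<sigma>2, a2)).
       (\<sigma>1, a1) \<in> ext_args S' A' \<and> (\<sigma>2, a2) \<in> ext_args S' A' \<and>
       (\<sigma>1 = \<sigma>2 \<longrightarrow> arg_equiv \<sigma>1 a1 a2) \<and> (\<sigma>1 \<noteq> \<sigma>2 \<longrightarrow> a1 = a2)}\<^sup>+"

definition conflicting :: "('a, 'v) schema set \<Rightarrow> 'a set \<Rightarrow> bool" where
  "conflicting S' A' \<longleftrightarrow>
    (\<exists>\<sigma>1 a1 \<sigma>2 a2.
       (\<sigma>1, a1) \<in> ext_args S' A' \<and> (\<sigma>2, a2) \<in> ext_args S' A' \<and>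
       a1 \<in> eargs \<sigma>1 \<and> a2 \<in> eargs \<sigma>2 \<and>
       ((\<sigma>1, a1), (\<sigma>2, a2)) \<in> collapsing S' A' \<and>
       (\<sigma>1 = \<sigma>2 \<longrightarrow> \<not> arg_equiv \<sigma>1 a1 a2))"

definition dependence ::
  "('a, 'v) schema set \<Rightarrow> 'a set \<Rightarrow> (('a, 'v) schema \<times> 'a) rel" where
  "dependence S' A' =
    {(e1, (\<sigma>, a2)).
       e1 \<in> ext_args S' A' \<and> (\<sigma>, a2) \<in> ext_args S' A' \<and>
       (\<exists>a. (\<sigma>, a) \<in> ext_args S' A' \<and> (e1, (\<sigma>, a)) \<in> collapsing S' A' \<and> arg_dep \<sigma> a a2)}"

definition overlapping :: "('a, 'v) schema set \<Rightarrow> 'a set \<Rightarrow> bool" where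
  "overlapping S' A' \<longleftrightarrow> \<not> conflicting S' A' \<and> acyclic (dependence S' A')"

end

(*
  The common tuple is computed on collapsing classes of extended arguments by recursion along the
  dependence graph. A class without an existential member receives a default value. In a class with
  an existential member (\<sigma>, b), the Skolem map of \<sigma> dictates the value, and it needs only the
  values of the universal arguments on which b depends, which are available as the dependence graph
  is acyclic. Absence of conflicts makes the value independent of the chosen existential member.
*)
theory Submission imports Defs begin

section \<open>Prefixes, schemas and acyclic relations\<close>

lemma qvars_eq_Un: "qvars p = evars p \<union> uvars p"
proof -
  have "qvar q \<in> evars p \<union> uvars p" if "q \<in> set p" for q
    by (cases q) (use that in \<open>auto simp: evars_def uvars_def\<close>)
  then show ?thesis
    by (force simp: qvars_def evars_def uvars_def)
qed

lemma evars_uvars_disjoint: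
  assumes "is_qprefix p"
  shows "evars p \<inter> uvars p = {}"
proof -
  have "inj_on qvar (set p)"
    using assms by (simp add: is_qprefix_def distinct_map)
  then show ?thesis
    by (auto simp: evars_def uvars_def dest: inj_onD[where x = "Exists _" and y = "Forall _"])
qed

lemma schema_var_cases:
  assumes "is_schema \<sigma>" "map_of (bpre \<sigma>) a = Some x"
  shows "(x \<in> evars (qpre \<sigma>) \<and> a \<in> eargs \<sigma>) \<or> (x \<in> uvars (qpre \<sigma>) \<and> a \<in> uargs \<sigma>)"
proof -
  have "x \<in> qvars (qpre \<sigma>)"
    using assms by (auto simp: is_schema_def intro: ranI)
  moreover have "evars (qpre \<sigma>) \<inter> uvars (qpre \<sigma>) = {}"
    using assms(1) by (intro evars_uvars_disjoint) (simp add: is_schema_def)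
  ultimately show ?thesis
    using assms(2) by (auto simp: qvars_eq_Un eargs_def uargs_def args_def)
qed

text \<open>In a path of \<open>d O r\<close> every inner \<open>r\<close> step precedes a
  \<open>d\<close> step and merges into it, so only a final \<open>r\<close> step survives. If the
  path is closed, that step merges into the first \<open>d\<close> step, leaving a cycle of
  \<open>d\<close>.\<close>

lemma acyclic_relcomp_absorb:
  assumes "acyclic d" and absorb: "r O d \<subseteq> d"
  shows "acyclic (d O r)"
proof -
  have absorb_trancl: "(x, z) \<in> d\<^sup>+" if "(x, y) \<in> r" "(y, z) \<in> d\<^sup>+" for x y z
    using that(2,1)
  proof (induction rule: trancl_induct)
    case (base z)
    then show ?case using absorb by blast
  next
    case (step z w)
    then show ?case by (meson trancl_into_trancl)
  qed
  have "\<exists>y. (x, y) \<in> d\<^sup>+ \<and> (y, z) \<in> r" if "(x, z) \<in> (d O r)\<^sup>+" for x z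
    using that
  proof (induction rule: trancl_induct)
    case (base z)
    then show ?case by blast
  next
    case (step z w)
    then obtain y v where "(x, y) \<in> d\<^sup>+" "(y, z) \<in> r" "(z, v) \<in> d" "(v, w) \<in> r"
      by blast
    then show ?case using absorb by (meson relcompI subsetD trancl_into_trancl)
  qed
  then show ?thesis
    using assms(1) absorb_trancl unfolding acyclic_def by meson
qed

section \<open>Collapsing classes and the well-founded order between them\<close>

lemma sym_collapsing: "sym (collapsing S' A')"
  unfolding collapsing_def by (rule sym_trancl) (auto simp: sym_def arg_equiv_def)

lemma trans_collapsing: "trans (collapsing S' A')"
  unfolding collapsing_def by (rule trans_trancl)

lemma collapsing_subset: "collapsing S' A' \<subseteq> ext_args S' A' \<times> ext_args S' A'"
  unfolding collapsing_def by (rule trancl_subset_Sigma) auto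

text \<open>The case \<open>\<sigma> = \<tau>\<close> supplies reflexivity on extended arguments;
  distinct schemas are what make one tuple serve all of them.\<close>

lemma collapsing_same_arg:
  assumes "(\<sigma>, a) \<in> ext_args S' A'" "(\<tau>, a) \<in> ext_args S' A'"
  shows "((\<sigma>, a), (\<tau>, a)) \<in> collapsing S' A'"
  unfolding collapsing_def using assms
  by (intro r_into_trancl) (auto simp: arg_equiv_def ext_args_def)

lemma collapsing_arg_equiv:
  assumes "(\<sigma>, a) \<in> ext_args S' A'" "(\<sigma>, b) \<in> ext_args S' A'" "arg_equiv \<sigma> a b"
  shows "((\<sigma>, a), (\<sigma>, b)) \<in> collapsing S' A'"
  unfolding collapsing_def using assms by (intro r_into_trancl) auto

text \<open>A dependence edge already begins with a collapsing step, so transitivity absorbs another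
  one in front.\<close>

lemma collapsing_dependence_subset:
  "collapsing S' A' O dependence S' A' \<subseteq> dependence S' A'"
proof (rule subsetI, elim relcompE)
  fix p e1 e2 e3
  assume p: "p = (e1, e3)" and e12: "(e1, e2) \<in> collapsing S' A'"
    and e23: "(e2, e3) \<in> dependence S' A'"
  have "e1 \<in> ext_args S' A'" using e12 collapsing_subset by blast
  moreover have "(e1, e) \<in> collapsing S' A'" if "(e2, e) \<in> collapsing S' A'" for e
    using transD[OF trans_collapsing e12 that] .
  ultimately show "p \<in> dependence S' A'"
    using e23 unfolding p dependence_def by blast
qed

text \<open>The trailing collapsing step is there because the value at a vertex is computed at a
  representative of its class: the predecessors of the vertex must include those of every
  member.\<close>

lemma wf_dependence_collapsing:
  fixes S' :: "('a::finite, 'v) schema set"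
  assumes "finite S'" "acyclic (dependence S' A')"
  shows "wf (dependence S' A' O collapsing S' A')"
proof (rule finite_acyclic_wf)
  have "finite (ext_args S' A')"
    by (rule finite_subset[of _ "S' \<times> UNIV"]) (auto simp: ext_args_def assms(1))
  then have "finite (ext_args S' A' \<times> ext_args S' A')"
    by simp
  moreover have "dependence S' A' \<subseteq> ext_args S' A' \<times> ext_args S' A'"
    by (auto simp: dependence_def)
  ultimately show "finite (dependence S' A' O collapsing S' A')"
    by (intro finite_relcomp) (blast intro: finite_subset finite_subset[OF collapsing_subset])+
  show "acyclic (dependence S' A' O collapsing S' A')"
    using assms(2) collapsing_dependence_subset by (rule acyclic_relcomp_absorb)
qed

section \<open>Universal assignments read off from argument values\<close>

text \<open>
  Values outside \<open>D\<close> are replaced by the default, so that the result is an assignment over \<open>D\<close> for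
  every \<open>t\<close>, also for the not yet meaningful ones inside the recursion.
\<close>

definition induced_asg ::
  "'d set \<Rightarrow> 'd \<Rightarrow> 'a set \<Rightarrow> ('a, 'v) schema \<Rightarrow> ('a \<Rightarrow> 'd) \<Rightarrow> 'v \<Rightarrow> 'd" where
  "induced_asg D d A' \<sigma> t = (\<lambda>x \<in> uvars (qpre \<sigma>).
    if \<exists>a \<in> A'. map_of (bpre \<sigma>) a = Some x
    then let v = t (SOME a. a \<in> A' \<and> map_of (bpre \<sigma>) a = Some x) in if v \<in> D then v else d
    else d)"

lemma induced_asg_in_Asg:
  assumes "d \<in> D"
  shows "induced_asg D d A' \<sigma> t \<in> Asg D (uvars (qpre \<sigma>))"
  using assms by (auto simp: induced_asg_def Asg_def Let_def)

text \<open>The choice of an argument bound to \<open>x\<close> does not involve \<open>t\<close>,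
  so both sides read the same argument. This locality makes the recursion admissible.\<close>

lemma induced_asg_cong:
  assumes "\<And>a. a \<in> A' \<Longrightarrow> map_of (bpre \<sigma>) a = Some x \<Longrightarrow> t1 a = t2 a"
  shows "induced_asg D d A' \<sigma> t1 x = induced_asg D d A' \<sigma> t2 x"
proof (cases "\<exists>a \<in> A'. map_of (bpre \<sigma>) a = Some x")
  case True
  then have "\<exists>a. a \<in> A' \<and> map_of (bpre \<sigma>) a = Some x" by blast
  from someI_ex[OF this] assms show ?thesis
    by (simp add: induced_asg_def restrict_def)
next
  case False
  then show ?thesis by (simp add: induced_asg_def restrict_def)
qed

lemma induced_asg_apply:
  assumes "a \<in> A'" "map_of (bpre \<sigma>) a = Some x" "x \<in> uvars (qpre \<sigma>)" "t a \<in> D"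
    and const: "\<And>b. b \<in> A' \<Longrightarrow> map_of (bpre \<sigma>) b = Some x \<Longrightarrow> t b = t a"
  shows "induced_asg D d A' \<sigma> t x = t a"
proof -
  have ex: "\<exists>b. b \<in> A' \<and> map_of (bpre \<sigma>) b = Some x" using assms by blast
  from someI_ex[OF this] const show ?thesis
    using assms(3,4) ex by (auto simp: induced_asg_def Let_def)
qed

section \<open>One step of the recursion\<close>

definition choose_existential ::
  "('a, 'v) schema set \<Rightarrow> 'a set \<Rightarrow> ('a, 'v) schema \<times> 'a \<Rightarrow> ('a, 'v) schema \<times> 'a" where
  "choose_existential S' A' e = (SOME f. (e, f) \<in> collapsing S' A' \<and> snd f \<in> eargs (fst f))"

definition value_step ::
  "'d set \<Rightarrow> 'd \<Rightarrow> (('a, 'v) schema \<Rightarrow> ('v \<Rightarrow> 'd) \<Rightarrow> ('v \<Rightarrow> 'd)) \<Rightarrow> ('a, 'v) schema set \<Rightarrow> 'a set \<Rightarrow>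
    (('a, 'v) schema \<times> 'a \<Rightarrow> 'd) \<Rightarrow> ('a, 'v) schema \<times> 'a \<Rightarrow> 'd" where
  "value_step D d c S' A' t e =
    (if \<exists>f. (e, f) \<in> collapsing S' A' \<and> snd f \<in> eargs (fst f)
     then case choose_existential S' A' e of (\<sigma>, b) \<Rightarrow>
       c \<sigma> (induced_asg D d A' \<sigma> (\<lambda>a. t (\<sigma>, a))) (the (map_of (bpre \<sigma>) b))
     else d)"

lemma choose_existential:
  assumes "\<exists>f. (e, f) \<in> collapsing S' A' \<and> snd f \<in> eargs (fst f)"
  obtains \<sigma> b x where "choose_existential S' A' e = (\<sigma>, b)" "(e, (\<sigma>, b)) \<in> collapsing S' A'"
    "(\<sigma>, b) \<in> ext_args S' A'" "b \<in> eargs \<sigma>" "map_of (bpre \<sigma>) b = Some x" "x \<in> evars (qpre \<sigma>)"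
proof -
  obtain \<sigma> b where *: "choose_existential S' A' e = (\<sigma>, b)"
    by (cases "choose_existential S' A' e")
  have **: "(e, (\<sigma>, b)) \<in> collapsing S' A'" "b \<in> eargs \<sigma>"
    using someI_ex[OF assms] * by (auto simp: choose_existential_def)
  moreover have "(\<sigma>, b) \<in> ext_args S' A'"
    using ** collapsing_subset by blast
  moreover obtain x where "map_of (bpre \<sigma>) b = Some x" "x \<in> evars (qpre \<sigma>)"
    using **(2) by (auto simp: eargs_def args_def)
  ultimately show ?thesis using * that by blast
qed

text \<open>Related vertices are related to the same extended arguments, so the choice operator
  selects the same representative for both.\<close>

lemma value_step_collapsing:
  assumes "(e, f) \<in> collapsing S' A'"
  shows "value_step D d c S' A' t e = value_step D d c S' A' t f"
proof -
  have "(e, g) \<in> collapsing S' A' \<longleftrightarrow> (f, g) \<in> collapsing S' A'" for g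
    using assms by (meson sym_collapsing trans_collapsing symD transD)
  then show ?thesis by (simp only: value_step_def choose_existential_def)
qed

text \<open>As \<open>induced_asg\<close> lands in \<open>D\<close> for arbitrary \<open>t\<close>,
  the fixed point takes values in \<open>D\<close> without an induction along the recursion.\<close>

lemma value_step_in:
  assumes "d \<in> D" "is_coupling_map S' D c"
  shows "value_step D d c S' A' t e \<in> D"
proof (cases "\<exists>f. (e, f) \<in> collapsing S' A' \<and> snd f \<in> eargs (fst f)")
  case True
  then obtain \<sigma> b x where *: "choose_existential S' A' e = (\<sigma>, b)"
    "(\<sigma>, b) \<in> ext_args S' A'" "map_of (bpre \<sigma>) b = Some x" "x \<in> evars (qpre \<sigma>)"
    by (rule choose_existential)
  then have "is_skolem_map (qpre \<sigma>) D (c \<sigma>)"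
    using assms(2) by (auto simp: is_coupling_map_def ext_args_def)
  then have "c \<sigma> (induced_asg D d A' \<sigma> u) \<in> Asg D (qvars (qpre \<sigma>))" for u
    using induced_asg_in_Asg[OF assms(1)] by (auto simp: is_skolem_map_def dest: PiE_mem)
  then have "c \<sigma> (induced_asg D d A' \<sigma> u) x \<in> D" for u
    using *(4) by (auto simp: Asg_def qvars_eq_Un dest: PiE_mem)
  then show ?thesis using True * by (simp add: value_step_def)
next
  case False
  then show ?thesis using assms(1) by (auto simp: value_step_def)
qed

text \<open>A Skolem value at \<open>y\<close> is determined by the variables in
  \<open>Dep (qpre \<sigma>) y\<close>, and the arguments of \<open>A'\<close> bound to these are
  predecessors in the recursion order.\<close>

lemma adm_wf_value_step:
  fixes S' :: "('a, 'v) schema set" and A' :: "'a set" and D :: "'d set"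
  assumes "d \<in> D" and coupling: "is_coupling_map S' D c" and schemas: "\<And>\<sigma>. \<sigma> \<in> S' \<Longrightarrow> is_schema \<sigma>"
  shows "adm_wf (dependence S' A' O collapsing S' A') (value_step D d c S' A')"
  unfolding adm_wf_def
proof (intro allI impI)
  fix t1 t2 :: "('a, 'v) schema \<times> 'a \<Rightarrow> 'd" and e :: "('a, 'v) schema \<times> 'a"
  assume agree: "\<forall>z. (z, e) \<in> dependence S' A' O collapsing S' A' \<longrightarrow> t1 z = t2 z"
  show "value_step D d c S' A' t1 e = value_step D d c S' A' t2 e"
  proof (cases "\<exists>f. (e, f) \<in> collapsing S' A' \<and> snd f \<in> eargs (fst f)")
    case True
    then obtain \<sigma> b y where f: "choose_existential S' A' e = (\<sigma>, b)"
      "(e, (\<sigma>, b)) \<in> collapsing S' A'" "(\<sigma>, b) \<in> ext_args S' A'" "b \<in> eargs \<sigma>"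
      "map_of (bpre \<sigma>) b = Some y" "y \<in> evars (qpre \<sigma>)"
      by (rule choose_existential)
    have "\<sigma> \<in> S'" using f(3) by (simp add: ext_args_def)
    define \<chi> where "\<chi> t = induced_asg D d A' \<sigma> (\<lambda>a. t (\<sigma>, a))"
      for t :: "('a, 'v) schema \<times> 'a \<Rightarrow> 'd"
    have "\<chi> t1 x = \<chi> t2 x" if "x \<in> Dep (qpre \<sigma>) y" for x
      unfolding \<chi>_def
    proof (rule induced_asg_cong)
      fix a assume a: "a \<in> A'" "map_of (bpre \<sigma>) a = Some x"
      have x: "x \<in> uvars (qpre \<sigma>)" "before (qpre \<sigma>) x y"
        using that by (auto simp: Dep_def)
      have "evars (qpre \<sigma>) \<inter> uvars (qpre \<sigma>) = {}"
        using schemas[OF \<open>\<sigma> \<in> S'\<close>] by (intro evars_uvars_disjoint) (simp add: is_schema_def)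
      then have "a \<in> uargs \<sigma>"
        using schema_var_cases[OF schemas[OF \<open>\<sigma> \<in> S'\<close>] a(2)] x(1) by blast
      then have "arg_dep \<sigma> a b"
        using a f x by (simp add: arg_dep_def)
      moreover have "(\<sigma>, a) \<in> ext_args S' A'"
        using a f(3) by (simp add: ext_args_def)
      \<comment> \<open>The collapsing step inside the edge is the reflexive one at
        \<open>(\<sigma>, a)\<close>.\<close>
      ultimately have "((\<sigma>, a), (\<sigma>, b)) \<in> dependence S' A'"
        using f(3) collapsing_same_arg by (fastforce simp: dependence_def)
      then have "((\<sigma>, a), e) \<in> dependence S' A' O collapsing S' A'"
        using symD[OF sym_collapsing f(2)] by blast
      then show "t1 (\<sigma>, a) = t2 (\<sigma>, a)" using agree by blast
    qed
    moreover have "\<chi> t \<in> Asg D (uvars (qpre \<sigma>))" for t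
      unfolding \<chi>_def using assms(1) by (rule induced_asg_in_Asg)
    moreover have "is_skolem_map (qpre \<sigma>) D (c \<sigma>)"
      using coupling \<open>\<sigma> \<in> S'\<close> by (simp add: is_coupling_map_def)
    ultimately have "c \<sigma> (\<chi> t1) y = c \<sigma> (\<chi> t2) y"
      using f(6) unfolding is_skolem_map_def by blast
    then show ?thesis using f(1,5) by (auto simp: value_step_def \<chi>_def)
  next
    case False
    then show ?thesis by (auto simp: value_step_def)
  qed
qed

text \<open>Without conflicts, the chosen existential member has the same schema and is bound to the
  same variable as \<open>a\<close>, so it dictates the same value.\<close>

lemma value_step_existential:
  assumes "\<not> conflicting S' A'" "(\<sigma>, a) \<in> ext_args S' A'" "a \<in> eargs \<sigma>"
  shows "value_step D d c S' A' t (\<sigma>, a) =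
    c \<sigma> (induced_asg D d A' \<sigma> (\<lambda>a. t (\<sigma>, a))) (the (map_of (bpre \<sigma>) a))"
proof -
  have ex: "\<exists>f. ((\<sigma>, a), f) \<in> collapsing S' A' \<and> snd f \<in> eargs (fst f)"
    using assms collapsing_same_arg[of \<sigma> a S' A' \<sigma>] by force
  then obtain \<tau> b y where f: "choose_existential S' A' (\<sigma>, a) = (\<tau>, b)"
    "((\<sigma>, a), (\<tau>, b)) \<in> collapsing S' A'" "(\<tau>, b) \<in> ext_args S' A'" "b \<in> eargs \<tau>"
    by (rule choose_existential)
  then have "\<sigma> = \<tau> \<and> arg_equiv \<sigma> a b"
    using assms unfolding conflicting_def by blast
  then show ?thesis
    using ex f(1) by (auto simp: value_step_def arg_equiv_def)
qed

section \<open>Construction of the common tuple\<close>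

theorem mainTheorem11:
  fixes S S' :: "('a::finite, 'v) schema set"
    and A A' :: "'a set"
    and D :: "'d set"
    and c :: "('a, 'v) schema \<Rightarrow> ('v \<Rightarrow> 'd) \<Rightarrow> ('v \<Rightarrow> 'd)"
  assumes "finite S"
    and "\<And>\<sigma>. \<sigma> \<in> S \<Longrightarrow> is_schema \<sigma>"
    and "A' \<subseteq> A"
    and "S' \<subseteq> S \<inter> Sch A"
    and "overlapping S' A'"
    and "D \<noteq> {}"
    and "is_coupling_map S D c"
  shows "entangled D c S' A'"
proof -
  obtain d where d: "d \<in> D" using assms(6) by blast
  have S': "finite S'" "\<And>\<sigma>. \<sigma> \<in> S' \<Longrightarrow> is_schema \<sigma>" "is_coupling_map S' D c"
    using assms(1,2,4,7) by (auto simp: is_coupling_map_def intro: finite_subset)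
  \<comment> \<open>Since schemas of \<open>S'\<close> have argument set \<open>A\<close>, which
    contains \<open>A'\<close>, the side condition on extended arguments holds
    automatically.\<close>
  have ext: "(\<sigma>, a) \<in> ext_args S' A' \<longleftrightarrow> \<sigma> \<in> S' \<and> a \<in> A'" for \<sigma> a
    using assms(3,4) by (auto simp: ext_args_def Sch_def)
  have overlap: "\<not> conflicting S' A'" "acyclic (dependence S' A')"
    using assms(5) by (simp_all add: overlapping_def)
  define v where "v = wfrec (dependence S' A' O collapsing S' A') (value_step D d c S' A')"
  have fixpoint: "v = value_step D d c S' A' v"
    unfolding v_def
    by (intro wfrec_fixpoint wf_dependence_collapsing adm_wf_value_step d S' overlap)
  have v_in: "v e \<in> D" for e
    by (subst fixpoint) (intro value_step_in d S')
  have v_collapsing: "v e = v f" if "(e, f) \<in> collapsing S' A'" for e f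
    using value_step_collapsing[OF that, of D d c v] fixpoint by simp
  \<comment> \<open>Any schema of \<open>S'\<close> may be consulted, as equal arguments collapse.
    For empty \<open>S'\<close> entanglement still asks for a tuple over \<open>D\<close>, and the
    constant \<open>d\<close> provides it.\<close>
  define w where "w a = (if S' = {} then d else v (SOME \<sigma>. \<sigma> \<in> S', a))" for a
  have w_in: "w a \<in> D" for a
    using d v_in by (simp add: w_def)
  have w_eq: "w a = v (\<sigma>, a)" if "\<sigma> \<in> S'" "a \<in> A'" for \<sigma> a
  proof -
    have "(SOME \<sigma>. \<sigma> \<in> S') \<in> S'" using that(1) by (rule someI)
    then have "((SOME \<sigma>. \<sigma> \<in> S', a), (\<sigma>, a)) \<in> collapsing S' A'"
      using that by (intro collapsing_same_arg) (auto simp: ext)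
    then show ?thesis using that(1) v_collapsing by (auto simp: w_def)
  qed
  define t where "t = (\<lambda>a. if a \<in> A' then Some (w a) else None)"
  have "dom t = A'" "ran t \<subseteq> D"
    using w_in by (auto simp: t_def dom_def ran_def)
  moreover have "\<exists>\<chi> \<in> c \<sigma> ` Asg D (uvars (qpre \<sigma>)).
      t = ((\<lambda>x. Some (\<chi> x)) \<circ>\<^sub>m map_of (bpre \<sigma>)) |` A'" if \<sigma>: "\<sigma> \<in> S'" for \<sigma>
  proof -
    \<comment> \<open>The values of \<open>v\<close> at universal arguments determine the input of
      the Skolem map; \<open>c \<sigma> \<chi>\<close> is then the required member of its
      range.\<close>
    define \<chi> where "\<chi> = induced_asg D d A' \<sigma> (\<lambda>a. v (\<sigma>, a))"
    have \<chi>: "\<chi> \<in> Asg D (uvars (qpre \<sigma>))"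
      unfolding \<chi>_def using d by (rule induced_asg_in_Asg)
    have skolem: "is_skolem_map (qpre \<sigma>) D (c \<sigma>)"
      using S'(3) \<sigma> by (simp add: is_coupling_map_def)
    have "\<exists>x. map_of (bpre \<sigma>) a = Some x \<and> w a = c \<sigma> \<chi> x" if a: "a \<in> A'" for a
    proof -
      have e: "(\<sigma>, a) \<in> ext_args S' A'" using a \<sigma> ext by blast
      then obtain x where x: "map_of (bpre \<sigma>) a = Some x"
        by (auto simp: ext_args_def args_def)
      have "v (\<sigma>, a) = c \<sigma> \<chi> x"
        using schema_var_cases[OF S'(2)[OF \<sigma>] x]
      proof (elim disjE conjE)
        assume "a \<in> eargs \<sigma>"
        then show ?thesis
          using value_step_existential[OF overlap(1) e, of D d c v] x
          by (simp add: \<chi>_def flip: fixpoint)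
      next
        assume ux: "x \<in> uvars (qpre \<sigma>)"
        \<comment> \<open>Several arguments may share \<open>x\<close>; they collapse, so whichever
          one \<open>induced_asg\<close> picks gives the value at \<open>a\<close>.\<close>
        have "v (\<sigma>, b) = v (\<sigma>, a)" if "b \<in> A'" "map_of (bpre \<sigma>) b = Some x" for b
        proof (rule v_collapsing, rule collapsing_arg_equiv)
          show "arg_equiv \<sigma> b a"
            using x that by (auto simp: arg_equiv_def args_def)
        qed (use that \<sigma> a ext in auto)
        then have "\<chi> x = v (\<sigma>, a)"
          unfolding \<chi>_def by (rule induced_asg_apply[OF a x ux v_in])
        \<comment> \<open>A Skolem map copies its input on universal variables.\<close>
        moreover have "c \<sigma> \<chi> x = \<chi> x"
          using skolem \<chi> ux unfolding is_skolem_map_def by blast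
        ultimately show ?thesis by simp
      qed
      then show ?thesis using w_eq[OF \<sigma> a] x by simp
    qed
    then have "t = ((\<lambda>x. Some (c \<sigma> \<chi> x)) \<circ>\<^sub>m map_of (bpre \<sigma>)) |` A'"
      by (fastforce simp: t_def restrict_map_def map_comp_def)
    then show ?thesis using \<chi> by blast
  qed
  ultimately show ?thesis unfolding entangled_def by blast
qed

end
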